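(* Let $K$ be a monomial ideal in $R=\Bbbk[x_1,\ldots,x_n]$, let $m$ be a monomial, and let $I=K+(m)$ and $J=K:(m)$. Let $d$ be a positive integer such that for all $i$ \[\operatorname{HF}(R/I,i)<\operatorname{HF}(R/I,i+d) \implies \operatorname{HF}(R/J,i-\deg(m)) \le \operatorname{HF}(R/J,i-\deg(m)+d)\] and \[\operatorname{HF}(R/I,i)>\operatorname{HF}(R/I,i+d) \implies \operatorname{HF}(R/J,i-\deg(m)) \ge \operatorname{HF}(R/J,i-\deg(m)+d).\] Let $f\in R$ be a form of degree $d$. If multiplication by $f$ has maximal rank in every degree in $R/I$ and in $R/J$, then multiplication by $f$ has maximal rank in every degree in $R/K$. In particular, if the two implications \[\operatorname{HF}(R/I,i)<\operatorname{HF}(R/I,i+d) \implies \operatorname{HF}(R/J,i-\deg(m)) \le \operatorname{HF}(R/J,i-\deg(m)+d)\] and \[\operatorname{HF}(R/I,i)>\operatorname{HF}(R/I,i+d) \implies \operatorname{HF}(R/J,i-\deg(m)) \ge \operatorname{HF}(R/J,i-\deg(m)+d)\] hold (for all $i$) for $d=1$ (respectively, for all $d\ge 1$), then $R/K$ has the WLP (respectively, the SLP) if both $R/I$ and $R/J$ do.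
   Context: $\Bbbk$ is a field of characteristic zero and $R=\Bbbk[x_1,\ldots,x_n]$ is the standard graded polynomial ring. For a graded algebra $S=R/\mathfrak{b}$ with $\mathfrak b$ a homogeneous ideal, $\operatorname{HF}(S,i)=\dim_\Bbbk S_i$ denotes the dimension of the $i$th graded component (with $S_i=0$ for $i<0$). For a form $f$ of degree $d$, multiplication by $f$ has maximal rank in every degree in $S$ if each map $\cdot f:S_i\to S_{i+d}$ is injective or surjective. A standard graded algebra $S$ has the weak Lefschetz property (WLP) if there is a linear form $\ell$ such that multiplication by $\ell$ has maximal rank in every degree in $S$; it has the strong Lefschetz property (SLP) if there is a linear form $\ell$ such that multiplication by $\ell^j$ has maximal rank in every degree in $S$, for all $j\ge 1$. (These properties are usually considered for Artinian algebras.) *)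

theory Defs
  imports "HOL-Library.Poly_Mapping" "HOL-Algebra.QuotRing" "Jordan_Normal_Form.VS_Connect"
begin

text \<open>
  Monomials are exponent vectors \<open>'n \<Rightarrow>\<^sub>0 nat\<close>. The polynomial ring \<open>\<bbbk>[x\<^sub>1,\<dots>,x\<^sub>n]\<close>,
  with \<open>n = CARD('n)\<close>, is the convolution ring \<open>('n \<Rightarrow>\<^sub>0 nat) \<Rightarrow>\<^sub>0 'k\<close>; as a HOL-Algebra
  structure it is \<^const>\<open>class_ring\<close> at this type.
\<close>

type_synonym 'n mon = "'n \<Rightarrow>\<^sub>0 nat"
type_synonym ('n, 'k) mpoly = "'n mon \<Rightarrow>\<^sub>0 'k"

abbreviation poly_ring :: "('n::finite, 'k::field_char_0) mpoly ring" where
  "poly_ring \<equiv> class_ring"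

definition mdeg :: "'n::finite mon \<Rightarrow> nat" where
  "mdeg t = (\<Sum>x\<in>UNIV. Poly_Mapping.lookup t x)"

definition mon_poly :: "'n::finite mon \<Rightarrow> ('n, 'k::field_char_0) mpoly" where
  "mon_poly t = Poly_Mapping.single t 1"

definition const_poly :: "'k::field_char_0 \<Rightarrow> ('n::finite, 'k) mpoly" where
  "const_poly c = Poly_Mapping.single 0 c"

text \<open>
  Degrees are integers, so that components of negative degree are zero. As usual, the zero
  polynomial counts as a form of every degree.
\<close>

definition forms :: "int \<Rightarrow> ('n::finite, 'k::field_char_0) mpoly set" where
  "forms i = {p. \<forall>t\<in>Poly_Mapping.keys p. int (mdeg t) = i}"

definition monomial_ideal :: "('n::finite, 'k::field_char_0) mpoly set \<Rightarrow> bool" where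
  "monomial_ideal K \<longleftrightarrow> (\<exists>M. K = Idl\<^bsub>poly_ring\<^esub> (mon_poly ` M))"

definition colon_ideal ::
    "('n::finite, 'k::field_char_0) mpoly set \<Rightarrow> ('n, 'k) mpoly set \<Rightarrow> ('n, 'k) mpoly set" where
  "colon_ideal A B = {r. \<forall>s\<in>B. r * s \<in> A}"

text \<open>
  The quotient ring as a \<open>\<bbbk>\<close>-algebra: the ring structure is \<open>poly_ring Quot b\<close>, and \<open>c\<close> acts
  as multiplication by the class of the constant polynomial \<open>c\<close>.
\<close>

definition quot_alg ::
    "('n::finite, 'k::field_char_0) mpoly set \<Rightarrow> ('k, ('n, 'k) mpoly set) module" where
  "quot_alg b =
     \<lparr>carrier = carrier (poly_ring Quot b),
      mult = mult (poly_ring Quot b),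
      one = one (poly_ring Quot b),
      zero = zero (poly_ring Quot b),
      add = add (poly_ring Quot b),
      smult = (\<lambda>c C. (b +>\<^bsub>poly_ring\<^esub> const_poly c) \<otimes>\<^bsub>poly_ring Quot b\<^esub> C)\<rparr>"

definition graded_comp ::
    "('n::finite, 'k::field_char_0) mpoly set \<Rightarrow> int \<Rightarrow> ('n, 'k) mpoly set set" where
  "graded_comp b i = (\<lambda>p. b +>\<^bsub>poly_ring\<^esub> p) ` forms i"

text \<open>
  \<open>vectorspace.dim\<close> is only meaningful for finite-dimensional spaces; the graded components of
  a quotient by an ideal are, being spanned by the classes of finitely many monomials.
\<close>

definition HF :: "('n::finite, 'k::field_char_0) mpoly set \<Rightarrow> int \<Rightarrow> nat" where
  "HF b i =
     vectorspace.dim (class_ring :: 'k ring) (quot_alg b\<lparr>carrier := graded_comp b i\<rparr>)"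

text \<open>
  The degree \<open>d\<close> is an explicit parameter, since the zero form does not determine it;
  it is meant to be used with \<open>f \<in> forms (int d)\<close>.
\<close>

definition mult_max_rank ::
    "('n::finite, 'k::field_char_0) mpoly set \<Rightarrow> nat \<Rightarrow> ('n, 'k) mpoly \<Rightarrow> bool" where
  "mult_max_rank b d f \<longleftrightarrow>
     (\<forall>i. let \<phi> = (\<lambda>C. (b +>\<^bsub>poly_ring\<^esub> f) \<otimes>\<^bsub>quot_alg b\<^esub> C) in
        inj_on \<phi> (graded_comp b i) \<or> \<phi> ` graded_comp b i = graded_comp b (i + int d))"

definition WLP :: "('n::finite, 'k::field_char_0) mpoly set \<Rightarrow> bool" where
  "WLP b \<longleftrightarrow> (\<exists>l\<in>forms 1. mult_max_rank b 1 l)"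

definition SLP :: "('n::finite, 'k::field_char_0) mpoly set \<Rightarrow> bool" where
  "SLP b \<longleftrightarrow> (\<exists>l\<in>forms 1. \<forall>j\<ge>1. mult_max_rank b j (l ^ j))"

text \<open>
  The two implications on Hilbert functions, for all \<open>i\<close>, where \<open>e\<close> is the degree of the
  monomial \<open>m\<close>. The shift \<open>i - e\<close> may be negative.
\<close>

definition HF_compatible ::
    "('n::finite, 'k::field_char_0) mpoly set \<Rightarrow> ('n, 'k) mpoly set \<Rightarrow> nat \<Rightarrow> nat \<Rightarrow> bool" where
  "HF_compatible I J e d \<longleftrightarrow>
     (\<forall>i::int.
        (HF I i < HF I (i + int d) \<longrightarrow> HF J (i - int e) \<le> HF J (i - int e + int d)) \<and>
        (HF I i > HF I (i + int d) \<longrightarrow> HF J (i - int e) \<ge> HF J (i - int e + int d)))"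

end

theory Submission
  imports Defs
begin

text \<open>
  Multiplication by \<open>f\<close> acts on the exact sequence
  \<open>0 \<rightarrow> (R/J)(-deg m) \<rightarrow> R/K \<rightarrow> R/I \<rightarrow> 0\<close>. The hypothesis on Hilbert functions says that in every
  degree the maps on \<open>R/I\<close> and \<open>R/J\<close> can be taken to be both injective or both surjective (if
  the two dimensions agree, either property implies the other), and then so is the map on \<open>R/K\<close>.

  For the Lefschetz properties the same linear form must serve \<open>I\<close> and \<open>J\<close>. Modulo a monomial
  ideal, whenever some linear form \<open>l\<close> works, so does the sum of the variables: give
  weight 1 to the variables missing in \<open>l\<close> and 0 to the others. Then \<open>l\<^sup>j\<close> is the
  lowest-weight part of \<open>(\<Sum> c\<^sub>x x)\<^sup>j\<close> for suitable nonzero \<open>c\<^sub>x\<close>, maximal rank passes from the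
  lowest-weight part to the whole form because the ideal is weight homogeneous, and rescaling the
  variables, which preserves the ideal, makes all \<open>c\<^sub>x\<close> equal to 1.
\<close>

section \<open>Linear maps between spaces of equal dimension\<close>

text \<open>A relation with coefficients \<open>a\<close> on the image pulls back to the relation
  with coefficients \<open>a \<circ> T\<close> on the basis: injectivity makes the two index sets
  correspond and sends a vanishing image back to zero.\<close>

lemma (in linear_map) inj_image_lin_indpt:
  assumes inj: "inj_on T (carrier V)" and B: "V.basis B" and fin: "finite B"
  shows "W.module.lin_indpt (T ` B)"
proof (rule W.module.finite_lin_indpt2)
  have BV: "B \<subseteq> carrier V" using B by (simp add: V.basis_def)
  show "finite (T ` B)" using fin by simp
  show "T ` B \<subseteq> carrier W" using BV by auto
  fix a assume a: "a \<in> T ` B \<rightarrow> carrier K" and lc: "W.module.lincomb a (T ` B) = \<zero>\<^bsub>W\<^esub>"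
  have aT: "a \<circ> T \<in> B \<rightarrow> carrier K" using a by auto
  have "T (V.module.lincomb (a \<circ> T) B) = T \<zero>\<^bsub>V\<^esub>"
    using lincomb_linear_image[OF inj BV a fin] lc by simp
  then have "V.module.lincomb (a \<circ> T) B = \<zero>\<^bsub>V\<^esub>"
    by (rule inj_onD[OF inj _ V.module.lincomb_closed[OF BV aT] V.module.M.zero_closed])
  then have "(a \<circ> T) \<in> B \<rightarrow> {\<zero>\<^bsub>K\<^esub>}"
    using B V.not_lindepD[OF _ fin subset_refl aT] by (simp add: V.basis_def)
  then show "\<forall>v\<in>T ` B. a v = \<zero>\<^bsub>K\<^esub>" by auto
qed

lemma (in linear_map) inj_imp_dim_le:
  assumes "V.fin_dim" "W.fin_dim" "inj_on T (carrier V)"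
  shows "V.dim \<le> W.dim"
proof -
  obtain B where B: "finite B" "V.basis B" using V.finite_basis_exists assms by blast
  then have BV: "B \<subseteq> carrier V" by (simp add: V.basis_def)
  have "card (T ` B) \<le> W.dim"
    using W.li_le_dim(2)[OF assms(2) _ inj_image_lin_indpt[OF assms(3) B(2,1)]] BV by auto
  then show ?thesis
    using V.dim_basis[OF B] card_image[OF inj_on_subset[OF assms(3) BV]] by simp
qed

text \<open>The image of a basis is independent and has \<open>W.dim\<close> elements, hence is a
  basis of the target; every target vector is then the image of the combination with pulled-back
  coefficients.\<close>

lemma (in linear_map) inj_dim_eq_imp_surj:
  assumes "V.fin_dim" "W.fin_dim" and inj: "inj_on T (carrier V)" and eq: "V.dim = W.dim"
  shows "T ` carrier V = carrier W"
proof -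
  obtain B where B: "finite B" "V.basis B" using V.finite_basis_exists assms by blast
  then have BV: "B \<subseteq> carrier V" by (simp add: V.basis_def)
  have "card (T ` B) = W.dim"
    using V.dim_basis[OF B] card_image[OF inj_on_subset[OF inj BV]] eq by simp
  then have "W.basis (T ` B)"
    using W.dim_li_is_basis[OF assms(2) _ _ inj_image_lin_indpt[OF inj B(2,1)]] B BV by auto
  then have gen: "W.module.span (T ` B) = carrier W" by (simp add: W.basis_def)
  have TB: "T ` B \<subseteq> carrier W" using BV by auto
  have "w \<in> T ` carrier V" if "w \<in> carrier W" for w
  proof -
    have "w \<in> W.module.span (T ` B)" using that gen by simp
    from W.module.finite_in_span[OF finite_imageI[OF B(1)] TB this]
    obtain a where a: "a \<in> T ` B \<rightarrow> carrier K" "W.module.lincomb a (T ` B) = w" by metis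
    then have "a \<circ> T \<in> B \<rightarrow> carrier K" by auto
    from imageI[OF V.module.lincomb_closed[OF BV this], of T] show ?thesis
      by (simp only: lincomb_linear_image[OF inj BV a(1) B(1), symmetric] a(2))
  qed
  then show ?thesis by auto
qed

lemma (in linear_map) surj_imp_dim_ge:
  assumes "V.fin_dim" and surj: "T ` carrier V = carrier W"
  shows "W.dim \<le> V.dim"
  using rank_nullity[OF assms(1)] surj_imp_imT_carrier[OF surj] by simp

text \<open>By rank-nullity the kernel has dimension 0. The remaining work is to conclude that it
  contains only the zero vector.\<close>

lemma (in linear_map) surj_dim_eq_imp_inj:
  assumes fd: "V.fin_dim" and surj: "T ` carrier V = carrier W" and eq: "V.dim = W.dim"
  shows "inj_on T (carrier V)"
proof -
  have sub: "subspace K kerT V" by (rule kerT_is_subspace)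
  interpret ker: vectorspace K "V.vs kerT" by (rule V.subspace_is_vs[OF sub])
  have smod: "submodule K kerT V" by (rule ker_is_submodule)
  have kV: "kerT \<subseteq> carrier V" by (auto simp: ker_def)
  have dim0: "ker.dim = 0"
    using rank_nullity[OF fd] surj_imp_imT_carrier[OF surj] eq by simp
  \<comment> \<open>The value of \<open>ker.dim\<close> says something about the kernel only once a
    finite basis is at hand. A maximal independent subset supplies one; its size is bounded by
    \<open>V.dim\<close>, since independence inside the kernel is independence in
    \<open>V\<close>.\<close>
  let ?P = "\<lambda>S. S \<subseteq> carrier (V.vs kerT) \<and> ker.lin_indpt S"
  have bound: "finite A \<and> card A \<le> V.dim" if "?P A" for A
  proof -
    have sub: "A \<subseteq> kerT" using conjunct1[OF that] by simp
    have A: "A \<subseteq> carrier V" by (rule subset_trans[OF sub kV])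
    have "V.module.lin_indpt A"
      using conjunct2[OF that] unfolding V.module.span_li_not_depend(2)[OF sub smod] .
    from V.li_le_dim[OF fd A this] show ?thesis by (rule conjI)
  qed
  have "?P {}" unfolding ker.lin_dep_def by blast
  from maximal_exists[of ?P, OF bound this]
  obtain A where fin: "finite A" and "maximal A ?P" by blast
  from this(2) have bas: "ker.basis A" by (rule ker.max_li_is_basis)
  have "card A = 0" using ker.dim_basis[OF fin bas] dim0 by metis
  then have "A = {}" using fin by (simp only: card_0_eq)
  then have "carrier (V.vs kerT) = {\<zero>\<^bsub>V.vs kerT\<^esub>}"
    using bas ker.span_empty unfolding ker.basis_def by metis
  then have "carrier (V.vs kerT) = {\<zero>\<^bsub>V\<^esub>}" by simp
  then show ?thesis by (rule Ke0_imp_inj)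
qed

section \<open>Graded components of quotients of the polynomial ring\<close>

abbreviation keys :: "('a \<Rightarrow>\<^sub>0 'b::zero) \<Rightarrow> 'a set" where "keys \<equiv> Poly_Mapping.keys"
abbreviation lookup :: "('a \<Rightarrow>\<^sub>0 'b::zero) \<Rightarrow> 'a \<Rightarrow> 'b" where "lookup \<equiv> Poly_Mapping.lookup"
abbreviation single :: "'a \<Rightarrow> 'b \<Rightarrow> 'a \<Rightarrow>\<^sub>0 'b::zero" where "single \<equiv> Poly_Mapping.single"

text \<open>Induction on the number of terms, splitting off one term at a time. It reduces additive
  statements about polynomials, such as membership in spans or ideals and identities additive in one
  factor, to single terms.\<close>

lemma keys_subset_closure:
  fixes X :: "('a \<Rightarrow>\<^sub>0 'b::ab_group_add) set"
  assumes "0 \<in> X" and add: "\<And>p q. p \<in> X \<Longrightarrow> q \<in> X \<Longrightarrow> p + q \<in> X"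
    and single: "\<And>t c. t \<in> T \<Longrightarrow> single t c \<in> X" and "keys p \<subseteq> T"
  shows "p \<in> X"
  using assms(4)
proof (induction "card (keys p)" arbitrary: p)
  case 0
  then show ?case using assms(1) by simp
next
  case (Suc n)
  then obtain t where t: "t \<in> keys p" by fastforce
  let ?s = "single t (lookup p t)"
  have k: "keys (p - ?s) = keys p - {t}"
    by (auto simp: in_keys_iff lookup_minus lookup_single when_def split: if_splits)
  then have "p - ?s \<in> X"
    using Suc t by (intro Suc.hyps(1)) auto
  moreover have "?s \<in> X" using single t Suc.prems by blast
  ultimately have "(p - ?s) + ?s \<in> X" by (rule add)
  then show ?case by simp
qed

lemma keys_uminus [simp]: "keys (- p) = keys p" for p :: "'a \<Rightarrow>\<^sub>0 'b::ab_group_add"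
  by (auto simp: in_keys_iff)

lemma keys_diff_subset: "keys (p - q) \<subseteq> keys p \<union> keys q" for p :: "'a \<Rightarrow>\<^sub>0 'b::ab_group_add"
  by (auto simp: in_keys_iff lookup_minus)

section \<open>Degrees of monomials and forms\<close>

lemma mdeg_add: "mdeg (s + t) = mdeg s + mdeg t"
  by (simp add: mdeg_def lookup_add sum.distrib)

lemma mdeg_0 [simp]: "mdeg 0 = 0"
  by (simp add: mdeg_def)

text \<open>Each exponent is at most the total degree, so only finitely many exponent functions are
  possible. This yields the finite spanning sets of the graded components.\<close>

lemma finite_mdeg: "finite {t :: 'n::finite mon. int (mdeg t) = i}"
proof -
  have "lookup t x \<le> nat i" if "int (mdeg t) = i" for t :: "'n mon" and x
  proof -
    have "lookup t x \<le> mdeg t"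
      unfolding mdeg_def by (rule member_le_sum) auto
    with that show ?thesis by linarith
  qed
  then have "lookup ` {t :: 'n mon. int (mdeg t) = i} \<subseteq> (UNIV \<rightarrow>\<^sub>E {..nat i})"
    by (auto simp: PiE_def)
  then have "finite (lookup ` {t :: 'n mon. int (mdeg t) = i})"
    by (rule finite_subset) (simp add: finite_PiE)
  then show ?thesis
    by (rule finite_imageD) (auto simp: inj_on_def intro: poly_mapping_eqI)
qed

lemma zero_in_forms [simp]: "0 \<in> forms i"
  by (simp add: forms_def)

lemma forms_add: "p \<in> forms i \<Longrightarrow> q \<in> forms i \<Longrightarrow> p + q \<in> forms i"
  using keys_add[of p q] by (auto simp: forms_def)

lemma forms_uminus: "p \<in> forms i \<Longrightarrow> - p \<in> forms i"
  by (simp add: forms_def)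

lemma forms_diff: "p \<in> forms i \<Longrightarrow> q \<in> forms i \<Longrightarrow> p - q \<in> forms i"
  using keys_diff_subset[of p q] by (auto simp: forms_def)

lemma forms_mult: "p \<in> forms i \<Longrightarrow> q \<in> forms j \<Longrightarrow> p * q \<in> forms (i + j)"
  using keys_mult[of p q] by (fastforce simp: forms_def mdeg_add)

lemma const_poly_in_forms: "const_poly c \<in> forms 0"
  by (simp add: forms_def const_poly_def)

lemma forms_const_mult: "p \<in> forms i \<Longrightarrow> const_poly c * p \<in> forms i"
  using forms_mult[OF const_poly_in_forms] by fastforce

lemma one_in_forms: "1 \<in> forms 0"
  by (simp add: forms_def)

lemma forms_power: "p \<in> forms 1 \<Longrightarrow> p ^ j \<in> forms (int j)"
proof (induction j)
  case (Suc j)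
  then show ?case using forms_mult[of p 1 "p ^ j" "int j"] by simp
qed (simp add: one_in_forms)

section \<open>Cosets and graded components of a quotient by an ideal\<close>

context
  fixes b :: "('n::finite, 'k::field_char_0) mpoly set"
  assumes b: "ideal b (poly_ring :: ('n, 'k) mpoly ring)"
begin

interpretation b: ideal b "poly_ring :: ('n, 'k) mpoly ring" by (rule b)

lemma ideal_zero: "0 \<in> b"
  using b.zero_closed by simp

lemma ideal_add: "p \<in> b \<Longrightarrow> q \<in> b \<Longrightarrow> p + q \<in> b"
  using b.a_closed by simp

lemma ideal_mult: "p \<in> b \<Longrightarrow> r * p \<in> b"
  using b.I_l_closed by simp

lemma ideal_uminus: "p \<in> b \<Longrightarrow> - p \<in> b"
  using ideal_mult[of p "- 1"] by simp

lemma ideal_diff: "p \<in> b \<Longrightarrow> q \<in> b \<Longrightarrow> p - q \<in> b"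
  using ideal_add[of p "- q"] ideal_uminus by simp

lemma coset_eq_iff: "b +>\<^bsub>poly_ring\<^esub> p = b +>\<^bsub>poly_ring\<^esub> q \<longleftrightarrow> p - q \<in> b"
proof
  have "p \<in> b +>\<^bsub>poly_ring\<^esub> p"
    using ideal_zero by (force simp: a_r_coset_def')
  moreover assume "b +>\<^bsub>poly_ring\<^esub> p = b +>\<^bsub>poly_ring\<^esub> q"
  ultimately have "p \<in> b +>\<^bsub>poly_ring\<^esub> q" by simp
  then obtain h where "h \<in> b" "p = h + q" by (auto simp: a_r_coset_def')
  then show "p - q \<in> b" by simp
next
  have sub: "b +>\<^bsub>poly_ring\<^esub> p \<subseteq> b +>\<^bsub>poly_ring\<^esub> q" if "p - q \<in> b" for p q
  proof
    fix x assume "x \<in> b +>\<^bsub>poly_ring\<^esub> p"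
    then obtain h where h: "h \<in> b" "x = h + p" by (auto simp: a_r_coset_def')
    then have "x = (h + (p - q)) + q" by simp
    with ideal_add[OF h(1) that] show "x \<in> b +>\<^bsub>poly_ring\<^esub> q"
      unfolding a_r_coset_def' by fastforce
  qed
  assume "p - q \<in> b"
  moreover from this have "q - p \<in> b" using ideal_uminus by fastforce
  ultimately show "b +>\<^bsub>poly_ring\<^esub> p = b +>\<^bsub>poly_ring\<^esub> q" using sub by blast
qed

lemma coset_zero: "b +>\<^bsub>poly_ring\<^esub> 0 = b"
  by (simp add: a_r_coset_def')

lemma quot_alg_add [simp]:
  "(b +>\<^bsub>poly_ring\<^esub> p) \<oplus>\<^bsub>quot_alg b\<^esub> (b +>\<^bsub>poly_ring\<^esub> q) = b +>\<^bsub>poly_ring\<^esub> (p + q)"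
  using b.a_rcos_sum[of p q] by (simp add: quot_alg_def FactRing_def)

lemma quot_alg_mult [simp]:
  "(b +>\<^bsub>poly_ring\<^esub> p) \<otimes>\<^bsub>quot_alg b\<^esub> (b +>\<^bsub>poly_ring\<^esub> q) = b +>\<^bsub>poly_ring\<^esub> (p * q)"
  using b.rcoset_mult_add[of p q] by (simp add: quot_alg_def FactRing_def)

lemma quot_alg_smult [simp]:
  "c \<odot>\<^bsub>quot_alg b\<^esub> (b +>\<^bsub>poly_ring\<^esub> q) = b +>\<^bsub>poly_ring\<^esub> (const_poly c * q)"
  using b.rcoset_mult_add[of "const_poly c" q] by (simp add: quot_alg_def FactRing_def)

lemma quot_alg_zero: "\<zero>\<^bsub>quot_alg b\<^esub> = b +>\<^bsub>poly_ring\<^esub> 0"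
  by (simp add: quot_alg_def FactRing_def coset_zero)

abbreviation graded_vs where "graded_vs i \<equiv> quot_alg b\<lparr>carrier := graded_comp b i\<rparr>"

lemma coset_in_graded_comp: "p \<in> forms i \<Longrightarrow> b +>\<^bsub>poly_ring\<^esub> p \<in> graded_comp b i"
  by (simp add: graded_comp_def)

lemma graded_vs_vectorspace: "vectorspace (class_ring :: 'k ring) (graded_vs i)"
proof -
  have cp: "const_poly (c * d) = const_poly c * const_poly d" 
     "const_poly (c + d) = const_poly c + const_poly d" "const_poly 1 = 1" for c d :: 'k
    by (simp_all add: const_poly_def mult_single single_add)
  have "module (class_ring :: 'k ring) (graded_vs i)"
  proof (rule module_criteria, goal_cases)
    case 1 show ?case by (rule class_cring.is_cring)
  next
    case 2 show ?case by (simp add: quot_alg_zero coset_in_graded_comp)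
  next
    case 4
    have "\<exists>w\<in>graded_comp b i. v \<oplus>\<^bsub>quot_alg b\<^esub> w = \<zero>\<^bsub>quot_alg b\<^esub>"
      if v: "v \<in> graded_comp b i" for v
    proof -
      obtain p where "p \<in> forms i" "v = b +>\<^bsub>poly_ring\<^esub> p" using v by (auto simp: graded_comp_def)
      then show ?thesis
        by (intro bexI[of _ "b +>\<^bsub>poly_ring\<^esub> (- p)"])
          (auto simp: quot_alg_zero coset_in_graded_comp forms_uminus)
    qed
    then show ?case by simp
  qed (auto simp: graded_comp_def quot_alg_zero forms_add forms_const_mult cp
      distrib_left distrib_right mult.assoc add_ac)
  then show ?thesis
    by (intro vectorspace.intro class_field)
qed

text \<open>The classes of the monomials of degree \<open>i\<close> span, because a form of degree
  \<open>i\<close> is a sum of constant multiples of such monomials.\<close>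

lemma graded_vs_fin_dim: "vectorspace.fin_dim (class_ring :: 'k ring) (graded_vs i)"
proof -
  interpret V: vectorspace "class_ring :: 'k ring" "graded_vs i" by (rule graded_vs_vectorspace)
  let ?T = "{t :: 'n mon. int (mdeg t) = i}"
  let ?A = "(\<lambda>t. b +>\<^bsub>poly_ring\<^esub> mon_poly t) ` ?T"
  have A: "?A \<subseteq> carrier (graded_vs i)"
    by (auto intro!: coset_in_graded_comp simp: forms_def mon_poly_def)
  have sm: "submodule (class_ring :: 'k ring) (V.module.span ?A) (graded_vs i)"
    by (rule V.module.span_is_submodule[OF A])
  have "b +>\<^bsub>poly_ring\<^esub> p \<in> V.module.span ?A" if p: "p \<in> forms i" for p
  proof -
    have "p \<in> {p. b +>\<^bsub>poly_ring\<^esub> p \<in> V.module.span ?A}"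
    proof (rule keys_subset_closure[of _ ?T])
      show "0 \<in> {p. b +>\<^bsub>poly_ring\<^esub> p \<in> V.module.span ?A}"
        using submodule.zero_closed[OF sm] by (simp add: quot_alg_zero)
    next
      fix p q
      assume "p \<in> {p. b +>\<^bsub>poly_ring\<^esub> p \<in> V.module.span ?A}"
        and "q \<in> {p. b +>\<^bsub>poly_ring\<^esub> p \<in> V.module.span ?A}"
      then show "p + q \<in> {p. b +>\<^bsub>poly_ring\<^esub> p \<in> V.module.span ?A}"
        using submodule.m_closed[OF sm, of "b +>\<^bsub>poly_ring\<^esub> p" "b +>\<^bsub>poly_ring\<^esub> q"] by simp
    next
      fix t :: "'n mon" and c :: 'k
      assume "t \<in> ?T"
      then have "b +>\<^bsub>poly_ring\<^esub> mon_poly t \<in> V.module.span ?A"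
        using V.module.in_own_span[OF A] by blast
      then show "single t c \<in> {p. b +>\<^bsub>poly_ring\<^esub> p \<in> V.module.span ?A}"
        using submodule.smult_closed[OF sm, of c]
        by (fastforce simp: const_poly_def mon_poly_def mult_single)
    next
      show "keys p \<subseteq> ?T" using p by (auto simp: forms_def)
    qed
    then show ?thesis by simp
  qed
  then have "carrier (graded_vs i) \<subseteq> V.module.span ?A"
    by (auto simp: graded_comp_def)
  moreover have "V.module.span ?A \<subseteq> carrier (graded_vs i)"
    using submodule.subset[OF sm] .
  ultimately show ?thesis
    unfolding V.fin_dim_def using finite_mdeg[of i] A by blast
qed

end

section \<open>Multiplication by a form, expressed on representatives\<close>

definition mult_inj ::
    "('n::finite, 'k::field_char_0) mpoly set \<Rightarrow> ('n, 'k) mpoly \<Rightarrow> int \<Rightarrow> bool" where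
  "mult_inj b f i \<longleftrightarrow> (\<forall>p\<in>forms i. f * p \<in> b \<longrightarrow> p \<in> b)"

definition mult_surj ::
    "('n::finite, 'k::field_char_0) mpoly set \<Rightarrow> ('n, 'k) mpoly \<Rightarrow> int \<Rightarrow> int \<Rightarrow> bool" where
  "mult_surj b f i j \<longleftrightarrow> (\<forall>q\<in>forms j. \<exists>p\<in>forms i. q - f * p \<in> b)"

context
  fixes b :: "('n::finite, 'k::field_char_0) mpoly set" and f :: "('n, 'k) mpoly" and d :: nat
  assumes b: "ideal b (poly_ring :: ('n, 'k) mpoly ring)" and f: "f \<in> forms (int d)"
begin

abbreviation "mult_map \<equiv> \<lambda>C. (b +>\<^bsub>poly_ring\<^esub> f) \<otimes>\<^bsub>quot_alg b\<^esub> C"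

lemma mult_map_coset: "mult_map (b +>\<^bsub>poly_ring\<^esub> p) = b +>\<^bsub>poly_ring\<^esub> (f * p)"
  by (rule quot_alg_mult[OF b])

text \<open>Multiplication is additive and differences of forms of one degree are again such forms,
  so testing the kernel suffices. From here on the arguments can use polynomials in place of
  cosets.\<close>

lemma inj_on_mult_map: "inj_on mult_map (graded_comp b i) \<longleftrightarrow> mult_inj b f i"
proof
  assume inj: "inj_on mult_map (graded_comp b i)"
  show "mult_inj b f i"
    unfolding mult_inj_def
  proof (intro ballI impI)
    fix p assume p: "p \<in> forms i" "f * p \<in> b"
    then have "mult_map (b +>\<^bsub>poly_ring\<^esub> p) = mult_map (b +>\<^bsub>poly_ring\<^esub> 0)"
      by (simp add: mult_map_coset coset_eq_iff[OF b])
    then have "b +>\<^bsub>poly_ring\<^esub> p = b +>\<^bsub>poly_ring\<^esub> 0"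
      by (rule inj_onD[OF inj]) (simp_all add: coset_in_graded_comp[OF b] p)
    then show "p \<in> b" by (simp add: coset_eq_iff[OF b])
  qed
next
  assume inj: "mult_inj b f i"
  show "inj_on mult_map (graded_comp b i)"
  proof (rule inj_onI)
    fix x y assume "x \<in> graded_comp b i" "y \<in> graded_comp b i" and eq: "mult_map x = mult_map y"
    then obtain p q where pq: "p \<in> forms i" "q \<in> forms i"
        "x = b +>\<^bsub>poly_ring\<^esub> p" "y = b +>\<^bsub>poly_ring\<^esub> q"
      by (auto simp: graded_comp_def)
    then have "f * (p - q) \<in> b"
      using eq by (simp add: mult_map_coset coset_eq_iff[OF b] right_diff_distrib)
    then show "x = y"
      using inj pq forms_diff[OF pq(1,2)] by (simp add: mult_inj_def coset_eq_iff[OF b])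
  qed
qed

lemma mult_map_image_subset: "mult_map ` graded_comp b i \<subseteq> graded_comp b (i + int d)"
proof
  fix y assume "y \<in> mult_map ` graded_comp b i"
  then obtain p where "p \<in> forms i" "y = b +>\<^bsub>poly_ring\<^esub> (f * p)"
    by (auto simp: graded_comp_def mult_map_coset)
  then show "y \<in> graded_comp b (i + int d)"
    using coset_in_graded_comp[OF b] forms_mult[OF f] by (simp add: add.commute)
qed

lemma mult_map_image:
  "mult_map ` graded_comp b i = graded_comp b (i + int d) \<longleftrightarrow> mult_surj b f i (i + int d)"
proof
  assume surj: "mult_map ` graded_comp b i = graded_comp b (i + int d)"
  show "mult_surj b f i (i + int d)"
    unfolding mult_surj_def
  proof
    fix q :: "('n, 'k) mpoly" assume "q \<in> forms (i + int d)"
    then have "b +>\<^bsub>poly_ring\<^esub> q \<in> mult_map ` graded_comp b i"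
      using surj coset_in_graded_comp[OF b] by simp
    then obtain p where "p \<in> forms i" "b +>\<^bsub>poly_ring\<^esub> q = b +>\<^bsub>poly_ring\<^esub> (f * p)"
      by (auto simp: graded_comp_def mult_map_coset)
    then show "\<exists>p\<in>forms i. q - f * p \<in> b" by (auto simp: coset_eq_iff[OF b])
  qed
next
  assume surj: "mult_surj b f i (i + int d)"
  have "graded_comp b (i + int d) \<subseteq> mult_map ` graded_comp b i"
  proof
    fix y assume "y \<in> graded_comp b (i + int d)"
    then obtain q where "q \<in> forms (i + int d)" and y: "y = b +>\<^bsub>poly_ring\<^esub> q"
      by (auto simp: graded_comp_def)
    then obtain p where p: "p \<in> forms i" "q - f * p \<in> b"
      using surj by (auto simp: mult_surj_def)
    then have "y = mult_map (b +>\<^bsub>poly_ring\<^esub> p)"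
      by (simp add: y mult_map_coset coset_eq_iff[OF b])
    then show "y \<in> mult_map ` graded_comp b i"
      using coset_in_graded_comp[OF b p(1)] by blast
  qed
  then show "mult_map ` graded_comp b i = graded_comp b (i + int d)"
    using mult_map_image_subset by blast
qed

lemma mult_max_rank_iff:
  "mult_max_rank b d f \<longleftrightarrow> (\<forall>i. mult_inj b f i \<or> mult_surj b f i (i + int d))"
  by (simp only: mult_max_rank_def Let_def inj_on_mult_map mult_map_image)

lemma linear_map_mult_map:
  "linear_map (class_ring :: 'k ring) (quot_alg b\<lparr>carrier := graded_comp b i\<rparr>)
     (quot_alg b\<lparr>carrier := graded_comp b (i + int d)\<rparr>) mult_map"
proof -
  interpret V: vectorspace "class_ring :: 'k ring" "quot_alg b\<lparr>carrier := graded_comp b i\<rparr>"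
    by (rule graded_vs_vectorspace[OF b])
  interpret W: vectorspace "class_ring :: 'k ring" "quot_alg b\<lparr>carrier := graded_comp b (i + int d)\<rparr>"
    by (rule graded_vs_vectorspace[OF b])
  have "mult_map \<in> LinearCombinations.module_hom (class_ring :: 'k ring) (quot_alg b\<lparr>carrier := graded_comp b i\<rparr>)
     (quot_alg b\<lparr>carrier := graded_comp b (i + int d)\<rparr>)"
    using mult_map_image_subset[of i]
    by (auto simp: LinearCombinations.module_hom_def graded_comp_def mult_map_coset quot_alg_add[OF b]
        quot_alg_smult[OF b] distrib_left mult.left_commute)
  then show ?thesis
    by unfold_locales
qed

lemma mult_inj_imp_HF_le: "mult_inj b f i \<Longrightarrow> HF b i \<le> HF b (i + int d)"
  using linear_map.inj_imp_dim_le[OF linear_map_mult_map graded_vs_fin_dim[OF b] graded_vs_fin_dim[OF b]]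
  by (simp add: HF_def inj_on_mult_map)

lemma mult_surj_imp_HF_ge: "mult_surj b f i (i + int d) \<Longrightarrow> HF b (i + int d) \<le> HF b i"
  using linear_map.surj_imp_dim_ge[OF linear_map_mult_map graded_vs_fin_dim[OF b]]
  by (simp add: HF_def mult_map_image)

text \<open>The components are finite-dimensional of equal dimension. This settles the borderline
  cases where the strict inequalities on Hilbert functions give no information.\<close>

lemma mult_inj_iff_surj:
  assumes "HF b i = HF b (i + int d)"
  shows "mult_inj b f i \<longleftrightarrow> mult_surj b f i (i + int d)"
  using linear_map.inj_dim_eq_imp_surj[OF linear_map_mult_map graded_vs_fin_dim[OF b] graded_vs_fin_dim[OF b], of i]
    linear_map.surj_dim_eq_imp_inj[OF linear_map_mult_map graded_vs_fin_dim[OF b], of i] assms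
  by (auto simp: HF_def inj_on_mult_map mult_map_image)

end

section \<open>Parts of a polynomial and weights\<close>

text \<open>Depending on \<open>P\<close>, this is a homogeneous component, a weight component, or
  the terms inside or outside a given set of monomials.\<close>

definition part :: "('a \<Rightarrow> bool) \<Rightarrow> ('a \<Rightarrow>\<^sub>0 'b::zero) \<Rightarrow> 'a \<Rightarrow>\<^sub>0 'b" where
  "part P p = Poly_Mapping.mapp (\<lambda>t c. c when P t) p"

lemma lookup_part: "lookup (part P p) t = (lookup p t when P t)"
  by (simp add: part_def lookup_mapp when_def in_keys_iff)

lemma keys_part: "keys (part P p) = {t \<in> keys p. P t}"
  by (auto simp: in_keys_iff lookup_part)

lemma part_add: "part P (p + q) = part P p + part P (q :: 'a \<Rightarrow>\<^sub>0 'b::monoid_add)"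
  by (rule poly_mapping_eqI) (simp add: lookup_part lookup_add when_add_distrib)

lemma part_diff: "part P (p - q) = part P p - part P (q :: 'a \<Rightarrow>\<^sub>0 'b::ab_group_add)"
  by (rule poly_mapping_eqI) (simp add: lookup_part lookup_minus when_diff_distrib)

lemma part_split: "part P p + part (\<lambda>t. \<not> P t) p = (p :: 'a \<Rightarrow>\<^sub>0 'b::monoid_add)"
  by (rule poly_mapping_eqI) (simp add: lookup_part lookup_add when_def)

lemma part_eq_self: "(\<And>t. t \<in> keys p \<Longrightarrow> P t) \<Longrightarrow> part P p = p"
  by (rule poly_mapping_eqI) (auto simp: lookup_part when_def in_keys_iff)

lemma part_eq_0: "(\<And>t. t \<in> keys p \<Longrightarrow> \<not> P t) \<Longrightarrow> part P p = 0"
  by (rule poly_mapping_eqI) (auto simp: lookup_part when_def in_keys_iff)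

lemma part_in_forms: "p \<in> forms i \<Longrightarrow> part P p \<in> forms i"
  by (auto simp: forms_def keys_part)

section \<open>Additive weights on monomials\<close>

context
  fixes \<omega> :: "'n::finite mon \<Rightarrow> int"
  assumes \<omega>_add: "\<omega> (s + t) = \<omega> s + \<omega> t"
begin

text \<open>A weight-homogeneous factor shifts all weights by \<open>d\<close>, so terms of
  \<open>p\<close> of weight other than \<open>i\<close> cannot contribute. It is applied both to
  the total degree and to the auxiliary weight of the last section.\<close>

lemma part_mult_weight:
  fixes f p :: "('n, 'k::field_char_0) mpoly"
  assumes "\<And>s. s \<in> keys f \<Longrightarrow> \<omega> s = d"
  shows "part (\<lambda>t. \<omega> t = d + i) (f * p) = f * part (\<lambda>t. \<omega> t = i) p"
proof -
  let ?P = "\<lambda>t. \<omega> t = i"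
  have "part (\<lambda>t. \<omega> t = d + i) (f * part ?P p) = f * part ?P p"
    using keys_mult[of f "part ?P p"] assms
    by (intro part_eq_self) (fastforce simp: keys_part \<omega>_add)
  moreover have "part (\<lambda>t. \<omega> t = d + i) (f * part (\<lambda>t. \<not> ?P t) p) = 0"
    using keys_mult[of f "part (\<lambda>t. \<not> ?P t) p"] assms
    by (intro part_eq_0) (fastforce simp: keys_part \<omega>_add)
  moreover have "f * p = f * part ?P p + f * part (\<lambda>t. \<not> ?P t) p"
    by (simp add: distrib_left[symmetric] part_split)
  ultimately show ?thesis
    by (simp only: part_add add_0_right)
qed

text \<open>A term of \<open>f\<close> of positive weight moves every term of \<open>p\<close>
  strictly above \<open>u\<close>, so only the weight-0 terms of \<open>f\<close> reach the lowest
  level.\<close>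

lemma part_mult_lowest:
  fixes f p :: "('n, 'k::field_char_0) mpoly"
  assumes nonneg: "\<And>s. 0 \<le> \<omega> s" and p: "\<And>t. t \<in> keys p \<Longrightarrow> u \<le> \<omega> t"
  shows "part (\<lambda>t. \<omega> t = u) (f * p) = part (\<lambda>t. \<omega> t = 0) f * part (\<lambda>t. \<omega> t = u) p"
proof -
  let ?f0 = "part (\<lambda>t. \<omega> t = 0) f" and ?f1 = "part (\<lambda>t. \<not> \<omega> t = 0) f"
  have "part (\<lambda>t. \<omega> t = 0 + u) (?f0 * p) = ?f0 * part (\<lambda>t. \<omega> t = u) p"
    by (rule part_mult_weight) (simp add: keys_part)
  moreover have "part (\<lambda>t. \<omega> t = u) (?f1 * p) = 0"
  proof (rule part_eq_0)
    fix t assume "t \<in> keys (?f1 * p)"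
    then obtain r s where "r \<in> keys ?f1" "s \<in> keys p" "t = r + s"
      using keys_mult[of ?f1 p] by blast
    then show "\<not> \<omega> t = u"
      using nonneg[of r] p[of s] by (simp add: keys_part \<omega>_add)
  qed
  moreover have "f * p = ?f0 * p + ?f1 * p"
    by (simp add: distrib_right[symmetric] part_split)
  ultimately show ?thesis
    by (simp add: part_add)
qed

lemma part_power_lowest:
  fixes f :: "('n, 'k::field_char_0) mpoly"
  assumes nonneg: "\<And>s. 0 \<le> \<omega> s"
  shows "part (\<lambda>t. \<omega> t = 0) (f ^ j) = part (\<lambda>t. \<omega> t = 0) f ^ j"
proof (induction j)
  case 0
  have "\<omega> 0 = 0" using \<omega>_add[of 0 0] by simp
  then show ?case by (simp, intro part_eq_self) simp
next
  case (Suc j)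
  then show ?case using part_mult_lowest[OF nonneg nonneg, of f "f ^ j"] by simp
qed

end

section \<open>Monomial ideals\<close>

lemmas ring_class_ring = cring.axioms(1)[OF class_cring.is_cring]

text \<open>Monomial ideals take this form. Membership depends on the support alone, which makes
  closure under \<open>part\<close> and under rescaling of variables immediate.\<close>

definition supp_ideal :: "'n::finite mon set \<Rightarrow> ('n, 'k::field_char_0) mpoly set" where
  "supp_ideal S = {p. keys p \<subseteq> S}"

definition upclosed :: "'n::finite mon set \<Rightarrow> bool" where
  "upclosed S \<longleftrightarrow> (\<forall>s\<in>S. \<forall>t. t + s \<in> S)"

lemma ideal_supp_ideal:
  assumes "upclosed S"
  shows "ideal (supp_ideal S) (poly_ring :: ('n::finite, 'k::field_char_0) mpoly ring)"
proof (rule idealI)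
  show "ring (poly_ring :: ('n, 'k) mpoly ring)" by (rule ring_class_ring)
  show "subgroup (supp_ideal S) (add_monoid (poly_ring :: ('n, 'k) mpoly ring))"
  proof (rule group.subgroupI)
    show "Group.group (add_monoid (poly_ring :: ('n, 'k) mpoly ring))"
      by (rule abelian_group.a_group[OF ring.is_abelian_group[OF ring_class_ring]])
    show "supp_ideal S \<noteq> ({} :: ('n, 'k) mpoly set)"
      by (auto simp: supp_ideal_def intro!: exI[of _ 0])
  next
    fix p :: "('n, 'k) mpoly" assume "p \<in> supp_ideal S"
    moreover have "\<ominus>\<^bsub>poly_ring\<^esub> p = - p" by (simp add: class_ring_simps)
    ultimately show "inv\<^bsub>add_monoid poly_ring\<^esub> p \<in> supp_ideal S"
      by (simp add: supp_ideal_def a_inv_def)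
  next
    fix p q :: "('n, 'k) mpoly" assume "p \<in> supp_ideal S" "q \<in> supp_ideal S"
    then show "p \<otimes>\<^bsub>add_monoid poly_ring\<^esub> q \<in> supp_ideal S"
      using keys_add[of p q] by (auto simp: supp_ideal_def)
  qed auto
next
  fix a x :: "('n, 'k) mpoly" assume "a \<in> supp_ideal S"
  then have "x * a \<in> supp_ideal S"
    using keys_mult[of x a] assms by (fastforce simp: supp_ideal_def upclosed_def)
  then show "x \<otimes>\<^bsub>poly_ring\<^esub> a \<in> supp_ideal S" "a \<otimes>\<^bsub>poly_ring\<^esub> x \<in> supp_ideal S"
    by (simp_all add: mult.commute)
qed

lemma supp_ideal_subset:
  fixes b :: "('n::finite, 'k::field_char_0) mpoly set"
  assumes b: "ideal b (poly_ring :: ('n, 'k) mpoly ring)"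
    and "\<And>s. s \<in> S \<Longrightarrow> \<exists>t m. s = t + m \<and> mon_poly m \<in> b"
  shows "supp_ideal S \<subseteq> b"
proof
  fix p :: "('n, 'k) mpoly" assume "p \<in> supp_ideal S"
  show "p \<in> b"
  proof (rule keys_subset_closure)
    fix s c assume "s \<in> S"
    then obtain t m where "s = t + m" "mon_poly m \<in> b" using assms(2) by blast
    then show "single s c \<in> b"
      using ideal_mult[OF b, of "mon_poly m" "single t c"] by (simp add: mon_poly_def mult_single)
  next
    show "keys p \<subseteq> S" using \<open>p \<in> supp_ideal S\<close> by (simp add: supp_ideal_def)
  qed (use ideal_zero[OF b] ideal_add[OF b] in auto)
qed

text \<open>\<open>S\<close> consists of all multiples of the generating monomials. One inclusion is
  minimality of the generated ideal, the other holds term by term.\<close>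

lemma monomial_ideal_eq_supp_ideal:
  fixes K :: "('n::finite, 'k::field_char_0) mpoly set"
  assumes "monomial_ideal K"
  obtains S where "upclosed S" "K = supp_ideal S"
proof -
  obtain M where K: "K = Idl\<^bsub>poly_ring\<^esub> (mon_poly ` M)"
    using assms by (auto simp: monomial_ideal_def)
  define S where "S = {t + s | t s. s \<in> M}"
  have up: "upclosed S"
    by (auto simp: upclosed_def S_def) (metis add.assoc)
  have id: "ideal K (poly_ring :: ('n, 'k) mpoly ring)"
    unfolding K by (rule ring.genideal_ideal[OF ring_class_ring]) simp
  have gen: "mon_poly ` M \<subseteq> K"
    unfolding K by (rule ring.genideal_self[OF ring_class_ring]) simp
  have "mon_poly ` M \<subseteq> supp_ideal S"
    by (force simp: supp_ideal_def mon_poly_def S_def intro: exI[of _ 0])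
  then have "K \<subseteq> supp_ideal S"
    unfolding K by (rule ring.genideal_minimal[OF ring_class_ring ideal_supp_ideal[OF up]])
  moreover have "supp_ideal S \<subseteq> K"
    using gen by (intro supp_ideal_subset[OF id]) (auto simp: S_def)
  ultimately show ?thesis using up that by blast
qed

section \<open>Sum and colon of a monomial ideal with a monomial\<close>

lemma lookup_mult_mon: "lookup (r * mon_poly m) (t + m) = lookup r t"
  for r :: "('n::finite, 'k::field_char_0) mpoly"
proof -
  \<comment> \<open>Both sides are additive in \<open>r\<close>, so the identity is checked on
    single terms, where multiplication by \<open>m\<close> is an injective shift of
    exponents.\<close>
  have "r \<in> {r. \<forall>t. lookup (r * mon_poly m) (t + m) = lookup r t}"
    by (rule keys_subset_closure[where T = UNIV])
      (auto simp: distrib_right lookup_add mon_poly_def mult_single lookup_single when_def)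
  then show ?thesis by simp
qed

lemma keys_mult_mon: "keys (r * mon_poly m) = (\<lambda>t. t + m) ` keys r"
  for r :: "('n::finite, 'k::field_char_0) mpoly"
proof
  show "keys (r * mon_poly m) \<subseteq> (\<lambda>t. t + m) ` keys r"
    using keys_mult[of r "mon_poly m"] by (auto simp: mon_poly_def)
  show "(\<lambda>t. t + m) ` keys r \<subseteq> keys (r * mon_poly m)"
    by (auto simp: in_keys_iff lookup_mult_mon)
qed

lemma PIdl_eq: "PIdl\<^bsub>poly_ring\<^esub> (a :: ('n::finite, 'k::field_char_0) mpoly) = {r * a | r. True}"
  by (simp add: cgenideal_def)

lemma ideal_sum_PIdl_eq:
  "K <+>\<^bsub>poly_ring\<^esub> PIdl\<^bsub>poly_ring\<^esub> a = {k + r * a | k r. k \<in> K}"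
  for a :: "('n::finite, 'k::field_char_0) mpoly"
  by (auto simp: set_add_def' PIdl_eq) 

lemma mem_ideal_sum_PIdl:
  "k \<in> K \<Longrightarrow> k + r * a \<in> K <+>\<^bsub>poly_ring\<^esub> PIdl\<^bsub>poly_ring\<^esub> a"
  for a :: "('n::finite, 'k::field_char_0) mpoly"
  by (auto simp: ideal_sum_PIdl_eq)

text \<open>Shows that \<open>I\<close> is again spanned by monomials; together with the analogous
  fact for the colon ideal, this makes the reduction to the sum of the variables available for
  \<open>I\<close> and \<open>J\<close> too.\<close>

lemma supp_ideal_add_mon:
  assumes up: "upclosed S"
  shows "supp_ideal S <+>\<^bsub>poly_ring\<^esub> PIdl\<^bsub>poly_ring\<^esub> (mon_poly m) =
    (supp_ideal (S \<union> range (\<lambda>t. t + m)) :: ('n::finite, 'k::field_char_0) mpoly set)"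
    (is "?I = _")
proof
  note id = ideal_supp_ideal[OF up]
  show "?I \<subseteq> supp_ideal (S \<union> range (\<lambda>t. t + m))"
  proof
    fix p :: "('n, 'k) mpoly" assume "p \<in> ?I"
    then obtain k r where "p = k + r * mon_poly m" "keys k \<subseteq> S"
      by (auto simp: ideal_sum_PIdl_eq supp_ideal_def)
    then show "p \<in> supp_ideal (S \<union> range (\<lambda>t. t + m))"
      using keys_add[of k "r * mon_poly m"] by (auto simp: supp_ideal_def keys_mult_mon)
  qed
  have idI: "ideal ?I (poly_ring :: ('n, 'k) mpoly ring)"
    by (intro ring.add_ideals[OF ring_class_ring] id cring.cgenideal_ideal[OF class_cring.is_cring]) simp
  have "mon_poly s \<in> ?I" if "s \<in> S" for s
    using that mem_ideal_sum_PIdl[of "mon_poly s" "supp_ideal S" 0]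
    by (simp add: supp_ideal_def mon_poly_def)
  moreover have "mon_poly m \<in> ?I"
    using mem_ideal_sum_PIdl[of 0 "supp_ideal S" 1] by (simp add: supp_ideal_def)
  ultimately show "supp_ideal (S \<union> range (\<lambda>t. t + m)) \<subseteq> ?I"
    by (intro supp_ideal_subset[OF idI]) (auto intro: exI[of _ 0])
qed

lemma mem_colon_ideal:
  assumes "ideal K (poly_ring :: ('n::finite, 'k::field_char_0) mpoly ring)"
  shows "r \<in> colon_ideal K (PIdl\<^bsub>poly_ring\<^esub> a) \<longleftrightarrow> r * a \<in> K"
proof
  assume "r \<in> colon_ideal K (PIdl\<^bsub>poly_ring\<^esub> a)"
  moreover have "a \<in> PIdl\<^bsub>poly_ring\<^esub> a" by (auto simp: PIdl_eq intro: exI[of _ 1])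
  ultimately show "r * a \<in> K" by (auto simp: colon_ideal_def)
next
  assume "r * a \<in> K"
  then show "r \<in> colon_ideal K (PIdl\<^bsub>poly_ring\<^esub> a)"
    using ideal_mult[OF assms] by (auto simp: colon_ideal_def PIdl_eq mult.left_commute)
qed

lemma supp_ideal_colon_mon:
  assumes up: "upclosed S"
  shows "colon_ideal (supp_ideal S) (PIdl\<^bsub>poly_ring\<^esub> (mon_poly m)) =
    (supp_ideal {t. t + m \<in> S} :: ('n::finite, 'k::field_char_0) mpoly set)"
proof (rule Set.set_eqI)
  fix r :: "('n, 'k) mpoly"
  have "r \<in> colon_ideal (supp_ideal S) (PIdl\<^bsub>poly_ring\<^esub> (mon_poly m)) \<longleftrightarrow> r * mon_poly m \<in> supp_ideal S"
    by (rule mem_colon_ideal[OF ideal_supp_ideal[OF up]])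
  then show "r \<in> colon_ideal (supp_ideal S) (PIdl\<^bsub>poly_ring\<^esub> (mon_poly m)) \<longleftrightarrow>
      r \<in> supp_ideal {t. t + m \<in> S}"
    by (auto simp: supp_ideal_def keys_mult_mon)
qed

section \<open>Maximal rank along the exact sequence\<close>

lemma int_mdeg_add: "int (mdeg (s + t)) = int (mdeg s) + int (mdeg t)"
  by (simp add: mdeg_add)

text \<open>Two four-lemma arguments, carried out on representatives, combine injectivity on
  \<open>I\<close> and \<open>J\<close> and likewise surjectivity. Comparing the two values of
  \<open>HF I\<close> decides which of them applies in a given degree.\<close>

lemma max_rank_exact:
  fixes K I J :: "('n::finite, 'k::field_char_0) mpoly set"
  assumes K: "K = supp_ideal S" and up: "upclosed S"
    and I: "I = K <+>\<^bsub>poly_ring\<^esub> PIdl\<^bsub>poly_ring\<^esub> (mon_poly m)"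
    and J: "J = colon_ideal K (PIdl\<^bsub>poly_ring\<^esub> (mon_poly m))"
    and compat: "HF_compatible I J (mdeg m) d" and f: "f \<in> forms (int d)"
    and rkI: "mult_max_rank I d f" and rkJ: "mult_max_rank J d f"
  shows "mult_max_rank K d f"
proof -
  let ?e = "int (mdeg m)" and ?m = "mon_poly m :: ('n, 'k) mpoly"
  have idK: "ideal K (poly_ring :: ('n, 'k) mpoly ring)"
    unfolding K by (rule ideal_supp_ideal[OF up])
  have idI: "ideal I (poly_ring :: ('n, 'k) mpoly ring)"
    unfolding I by (intro ring.add_ideals[OF ring_class_ring] idK cring.cgenideal_ideal[OF class_cring.is_cring]) simp
  have "upclosed {t. t + m \<in> S}"
    using up by (auto simp: upclosed_def add.assoc)
  then have idJ: "ideal J (poly_ring :: ('n, 'k) mpoly ring)"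
    unfolding J K supp_ideal_colon_mon[OF up] by (rule ideal_supp_ideal)
  have memJ: "r \<in> J \<longleftrightarrow> r * ?m \<in> K" for r
    unfolding J by (rule mem_colon_ideal[OF idK])
  have KI: "p \<in> I" if "p \<in> K" for p
    using that mem_ideal_sum_PIdl[of p K 0] by (simp add: I)
  have mI: "r * ?m \<in> forms i" if "r \<in> forms (i - ?e)" for r :: "('n, 'k) mpoly" and i
    using forms_mult[OF that, of ?m ?e] by (simp add: forms_def mon_poly_def)
  \<comment> \<open>multiplication by \<open>m\<close> identifies \<open>R/J\<close>, shifted by \<open>deg m\<close>, with the kernel of \<open>R/K \<rightarrow> R/I\<close>\<close>
  have lift: "\<exists>r\<in>forms (i - ?e). p - r * ?m \<in> K" if p: "p \<in> forms i" "p \<in> I" for p i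
  proof -
    obtain k r where k: "k \<in> K" and p_eq: "p = k + r * ?m"
      using p(2) unfolding I ideal_sum_PIdl_eq by blast
    \<comment> \<open>The cofactor \<open>r\<close> need not be homogeneous; comparing components of
      degree \<open>i\<close> shows that its component of degree \<open>i - ?e\<close> already
      works.\<close>
    let ?r = "part (\<lambda>t. int (mdeg t) = i - ?e) r"
    have "p = part (\<lambda>t. int (mdeg t) = i) p"
      using p(1) by (intro part_eq_self[symmetric]) (auto simp: forms_def)
    also have "\<dots> = part (\<lambda>t. int (mdeg t) = i) k + part (\<lambda>t. int (mdeg t) = ?e + (i - ?e)) (?m * r)"
      by (simp add: p_eq part_add mult.commute)
    also have "\<dots> = part (\<lambda>t. int (mdeg t) = i) k + ?m * ?r"
      by (subst part_mult_weight[OF int_mdeg_add]) (simp_all add: mon_poly_def)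
    finally have "p - ?r * ?m = part (\<lambda>t. int (mdeg t) = i) k"
      by (simp add: mult.commute)
    moreover have "part (\<lambda>t. int (mdeg t) = i) k \<in> K"
      using k by (auto simp: K supp_ideal_def keys_part)
    moreover have "?r \<in> forms (i - ?e)"
      by (simp add: forms_def keys_part)
    ultimately show ?thesis by metis
  qed
  have inj: "mult_inj K f i" if injI: "mult_inj I f i" and injJ: "mult_inj J f (i - ?e)" for i
    unfolding mult_inj_def
  proof (intro ballI impI)
    fix p assume p: "p \<in> forms i" and fp: "f * p \<in> K"
    then have "p \<in> I" using injI KI by (auto simp: mult_inj_def)
    then obtain r where r: "r \<in> forms (i - ?e)" and pr: "p - r * ?m \<in> K"
      using lift p by blast
    \<comment> \<open>The difference equals \<open>f * r * ?m\<close>, so the kernel element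
      \<open>p\<close> has been traded for the element \<open>r\<close> of the kernel on
      \<open>J\<close>.\<close>
    have "f * p - f * (p - r * ?m) \<in> K"
      by (intro ideal_diff[OF idK] fp ideal_mult[OF idK] pr)
    then have "f * r \<in> J"
      by (simp add: memJ right_diff_distrib mult.assoc)
    then have "r * ?m \<in> K" using injJ r by (simp add: mult_inj_def memJ)
    from ideal_add[OF idK pr this] show "p \<in> K" by simp
  qed
  have surj: "mult_surj K f i (i + int d)"
    if surjI: "mult_surj I f i (i + int d)" and surjJ: "mult_surj J f (i - ?e) (i - ?e + int d)" for i
    unfolding mult_surj_def
  proof
    fix q :: "('n, 'k) mpoly" assume q: "q \<in> forms (i + int d)"
    then obtain p where p: "p \<in> forms i" and qp: "q - f * p \<in> I"
      using surjI by (auto simp: mult_surj_def)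
    have "q - f * p \<in> forms (i + int d)"
      using forms_diff[OF q, of "f * p"] forms_mult[OF f p] by (simp add: add.commute)
    then obtain r where "r \<in> forms (i + int d - ?e)" and qr: "q - f * p - r * ?m \<in> K"
      using lift qp by blast
    then obtain s where s: "s \<in> forms (i - ?e)" and rs: "r - f * s \<in> J"
      using surjJ unfolding mult_surj_def by (metis diff_add_eq)
    \<comment> \<open>The preimage \<open>p\<close> modulo \<open>I\<close> leaves an error
      \<open>r * ?m\<close> modulo \<open>K\<close>; solving \<open>r = f * s\<close> modulo
      \<open>J\<close> corrects it.\<close>
    have "q - f * (p + s * ?m) = (q - f * p - r * ?m) + (r - f * s) * ?m"
      by (simp add: algebra_simps)
    also have "\<dots> \<in> K"
      by (intro ideal_add[OF idK] qr) (use rs memJ in simp)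
    finally show "\<exists>p\<in>forms i. q - f * p \<in> K"
      using forms_add[OF p mI[OF s]] by blast
  qed
  note iffs = mult_max_rank_iff[OF idI f] mult_max_rank_iff[OF idJ f] mult_max_rank_iff[OF idK f]
  have "mult_inj K f i \<or> mult_surj K f i (i + int d)" for i
  proof -
    note injI = mult_inj_imp_HF_le[OF idI f, of i] and surjI = mult_surj_imp_HF_ge[OF idI f, of i]
      and eqI = mult_inj_iff_surj[OF idI f, of i]
      and injJ = mult_inj_imp_HF_le[OF idJ f, of "i - ?e"]
      and surjJ = mult_surj_imp_HF_ge[OF idJ f, of "i - ?e"]
      and eqJ = mult_inj_iff_surj[OF idJ f, of "i - ?e"]
    have mI: "mult_inj I f i \<or> mult_surj I f i (i + int d)"
      and mJ: "mult_inj J f (i - ?e) \<or> mult_surj J f (i - ?e) (i - ?e + int d)"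
      using rkI rkJ by (simp_all add: iffs)
    consider "HF I i < HF I (i + int d)" | "HF I i > HF I (i + int d)" | "HF I i = HF I (i + int d)"
      by linarith
    then show ?thesis
    proof cases
      case 1
      \<comment> \<open>Surjectivity on \<open>I\<close> would contradict the strict inequality. On
        \<open>J\<close> the inequality is only weak: surjectivity there forces equal dimensions,
        and \<open>eqJ\<close> then returns injectivity.\<close>
      then have "mult_inj I f i" using mI surjI by linarith
      moreover have "HF J (i - ?e) \<le> HF J (i - ?e + int d)"
        using 1 compat by (simp add: HF_compatible_def)
      then have "mult_inj J f (i - ?e)" using mJ surjJ eqJ by linarith
      ultimately show ?thesis using inj by blast
    next
      case 2
      then have "mult_surj I f i (i + int d)" using mI injI by linarith
      moreover have "HF J (i - ?e) \<ge> HF J (i - ?e + int d)"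
        using 2 compat by (simp add: HF_compatible_def)
      then have "mult_surj J f (i - ?e) (i - ?e + int d)" using mJ injJ eqJ by linarith
      ultimately show ?thesis using surj by blast
    next
      case 3
      \<comment> \<open>Here the map on \<open>I\<close> is both injective and surjective, so
        whichever property holds on \<open>J\<close> passes to \<open>K\<close>.\<close>
      then show ?thesis using mI mJ eqI inj surj by blast
    qed
  qed
  then show ?thesis by (simp add: iffs)
qed

section \<open>Reduction to the sum of the variables\<close>

text \<open>
  If the lowest-weight part of a form has maximal rank, so does the form: look at the
  lowest-weight part of a kernel element outside the ideal, and solve \<open>q = f p\<close> modulo the ideal
  one weight after the other.
\<close>

lemma mult_inj_lowest:
  fixes f :: "('n::finite, 'k::field_char_0) mpoly"
  assumes up: "upclosed S"
    and \<omega>_add: "\<And>s t. \<omega> (s + t) = \<omega> s + (\<omega> t :: int)" and nonneg: "\<And>s. 0 \<le> \<omega> s"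
    and inj: "mult_inj (supp_ideal S) (part (\<lambda>t. \<omega> t = 0) f) i"
  shows "mult_inj (supp_ideal S) f i"
  unfolding mult_inj_def
proof (intro ballI impI, rule ccontr)
  note id = ideal_supp_ideal[OF up]
  fix p :: "('n, 'k) mpoly"
  assume p: "p \<in> forms i" "f * p \<in> supp_ideal S" "p \<notin> supp_ideal S"
  \<comment> \<open>Discarding the terms in \<open>S\<close> changes \<open>p\<close> only by an
    element of the ideal and ensures that no term of the lowest-weight part lies in the
    ideal.\<close>
  define p' where "p' = part (\<lambda>t. t \<notin> S) p"
  have "f * p' = f * p - f * part (\<lambda>t. t \<in> S) p"
    using part_split[of "\<lambda>t. t \<in> S" p, symmetric]
    by (metis p'_def add_diff_cancel_left' right_diff_distrib)
  moreover have "part (\<lambda>t. t \<in> S) p \<in> supp_ideal S" by (auto simp: supp_ideal_def keys_part)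
  ultimately have fp': "f * p' \<in> supp_ideal S"
    using p(2) ideal_diff[OF id] ideal_mult[OF id] by metis
  have "keys p' \<noteq> {}" using p(3) by (auto simp: p'_def keys_part supp_ideal_def)
  then obtain t where t: "t \<in> keys p'" and min: "\<And>s. s \<in> keys p' \<Longrightarrow> \<omega> t \<le> \<omega> s"
    using arg_min_least[of "keys p'" _ \<omega>] arg_min_if_finite(1)[of "keys p'" \<omega>] by auto
  let ?q = "part (\<lambda>s. \<omega> s = \<omega> t) p'"
  have "part (\<lambda>s. \<omega> s = \<omega> t) (f * p') \<in> supp_ideal S"
    using fp' by (auto simp: supp_ideal_def keys_part)
  then have "part (\<lambda>s. \<omega> s = 0) f * ?q \<in> supp_ideal S"
    by (simp add: part_mult_lowest[OF \<omega>_add nonneg min])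
  moreover have "?q \<in> forms i" using p(1) by (simp add: p'_def part_in_forms)
  ultimately have "?q \<in> supp_ideal S" using inj by (auto simp: mult_inj_def)
  moreover have "t \<in> keys ?q" "t \<notin> S" using t by (auto simp: keys_part p'_def)
  ultimately show False by (auto simp: supp_ideal_def)
qed

lemma mult_surj_lowest:
  fixes f :: "('n::finite, 'k::field_char_0) mpoly"
  assumes up: "upclosed S"
    and \<omega>_add: "\<And>s t. \<omega> (s + t) = \<omega> s + (\<omega> t :: int)" and nonneg: "\<And>s. 0 \<le> \<omega> s"
    and bound: "\<And>s. \<omega> s \<le> int (mdeg s)" and f: "f \<in> forms d"
    and surj: "mult_surj (supp_ideal S) (part (\<lambda>t. \<omega> t = 0) f) i (i + d)"
  shows "mult_surj (supp_ideal S) f i (i + d)"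
proof -
  note id = ideal_supp_ideal[OF up]
  let ?f0 = "part (\<lambda>t. \<omega> t = 0) f" and ?f1 = "part (\<lambda>t. \<not> \<omega> t = 0) f"
  have "\<exists>p\<in>forms i. q - f * p \<in> supp_ideal S"
    if "q \<in> forms (i + d)" "\<And>t. t \<in> keys q \<Longrightarrow> u \<le> \<omega> t" for q u
    using that
  \<comment> \<open>The weight is at most the degree, so a form of degree \<open>i + d\<close> whose
    weights are all at least \<open>u > i + d\<close> is zero; this is the base case.\<close>
  proof (induction "nat (i + d + 1 - u)" arbitrary: q u)
    case 0
    have "u \<le> i + d" if "t \<in> keys q" for t
      using 0(2,3) that bound[of t] by (force simp: forms_def)
    then have "t \<notin> keys q" for t using 0(1) by fastforce
    then have "keys q = {}" by blast
    then have "q = 0" by simp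
    then show ?case by (intro bexI[of _ 0]) (auto simp: ideal_zero[OF id])
  next
    case (Suc n)
    let ?u = "part (\<lambda>t. \<omega> t = u)"
    obtain p where p: "p \<in> forms i" "?u q - ?f0 * p \<in> supp_ideal S"
      using surj part_in_forms[OF Suc.prems(1)] unfolding mult_surj_def by blast
    \<comment> \<open>Only the weight-\<open>u\<close> part of the solution is kept. It still solves
      the weight-\<open>u\<close> equation, and its product with the positive-weight part of
      \<open>f\<close> then lies entirely above \<open>u\<close>.\<close>
    have pu: "?u p \<in> forms i" using p(1) by (rule part_in_forms)
    have "?u (?f0 * p) = ?f0 * ?u p"
      using part_mult_weight[OF \<omega>_add, of ?f0 0 u p] by (simp add: keys_part)
    moreover have "?u (?u q) = ?u q" by (rule part_eq_self) (simp add: keys_part)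
    ultimately have "?u (?u q - ?f0 * p) = ?u q - ?f0 * ?u p" by (simp add: part_diff)
    moreover have "?u (?u q - ?f0 * p) \<in> supp_ideal S"
      using p(2) by (auto simp: supp_ideal_def keys_part)
    ultimately have 1: "?u q - ?f0 * ?u p \<in> supp_ideal S" by simp
    let ?q = "part (\<lambda>t. \<not> \<omega> t = u) q - ?f1 * ?u p"
    have q': "?q \<in> forms (i + d)"
      using forms_mult[OF part_in_forms[OF f] pu] part_in_forms[OF Suc.prems(1)]
      by (intro forms_diff) (simp_all add: add.commute)
    have "u + 1 \<le> \<omega> t" if t: "t \<in> keys ?q" for t
    proof -
      consider "t \<in> keys (part (\<lambda>t. \<not> \<omega> t = u) q)" | "t \<in> keys (?f1 * ?u p)"
        using t keys_diff_subset[of "part (\<lambda>t. \<not> \<omega> t = u) q" "?f1 * ?u p"] by blast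
      then show ?thesis
      proof cases
        case 1
        then show ?thesis using Suc.prems(2)[of t] by (auto simp: keys_part)
      next
        case 2
        then obtain r s where "r \<in> keys ?f1" "s \<in> keys (?u p)" "t = r + s"
          using keys_mult[of ?f1 "?u p"] by blast
        then show ?thesis using nonneg[of r] by (simp add: keys_part \<omega>_add)
      qed
    qed
    moreover have "n = nat (i + d + 1 - (u + 1))" using Suc.hyps(2) by linarith
    ultimately obtain p' where p': "p' \<in> forms i" "?q - f * p' \<in> supp_ideal S"
      using Suc.hyps(1)[of "u + 1" ?q] q' by blast
    have "q - f * (p' + ?u p) = (?u q + part (\<lambda>t. \<not> \<omega> t = u) q) - f * p' - (?f0 + ?f1) * ?u p"
      by (simp only: part_split) (simp add: algebra_simps)
    also have "\<dots> = (?q - f * p') + (?u q - ?f0 * ?u p)"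
      by (simp add: algebra_simps)
    also have "\<dots> \<in> supp_ideal S" by (rule ideal_add[OF id p'(2) 1])
    finally show ?case using forms_add[OF p'(1) pu] by blast
  qed
  \<comment> \<open>Nonnegative weights allow the induction to start at
    \<open>u = 0\<close>.\<close>
  then show ?thesis
    unfolding mult_surj_def using nonneg by blast
qed

section \<open>Rescaling of the variables\<close>

definition mon_eval :: "('n \<Rightarrow> 'k) \<Rightarrow> 'n::finite mon \<Rightarrow> 'k::field_char_0" where
  "mon_eval a t = (\<Prod>x\<in>UNIV. a x ^ lookup t x)"

text \<open>This is the substitution of \<open>a x\<close> times x for every variable x, written on
  coefficients. If no \<open>a x\<close> vanishes, it is a degree-preserving automorphism that maps
  each ideal \<open>supp_ideal S\<close> onto itself.\<close>

definition rescale :: "('n \<Rightarrow> 'k) \<Rightarrow> ('n::finite, 'k::field_char_0) mpoly \<Rightarrow> ('n, 'k) mpoly" where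
  "rescale a p = Poly_Mapping.mapp (\<lambda>t c. c * mon_eval a t) p"

lemma mon_eval_add: "mon_eval a (s + t) = mon_eval a s * mon_eval a t"
  by (simp add: mon_eval_def lookup_add power_add prod.distrib)

lemma mon_eval_inverse: "(\<And>x. a x \<noteq> 0) \<Longrightarrow> mon_eval a t * mon_eval (\<lambda>x. inverse (a x)) t = 1"
  by (simp add: mon_eval_def prod.distrib[symmetric] power_mult_distrib[symmetric])

lemma mon_eval_var: "mon_eval a (single x 1) = a x"
  by (simp add: mon_eval_def lookup_single when_def if_distrib[of "\<lambda>n. _ ^ n"] prod.delta' cong: if_cong)

lemma lookup_rescale: "lookup (rescale a p) t = lookup p t * mon_eval a t"
  by (simp add: rescale_def lookup_mapp when_def in_keys_iff)

lemma rescale_add: "rescale a (p + q) = rescale a p + rescale a q"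
  by (rule poly_mapping_eqI) (simp add: lookup_rescale lookup_add distrib_right)

lemma rescale_diff: "rescale a (p - q) = rescale a p - rescale a q"
  by (rule poly_mapping_eqI) (simp add: lookup_rescale lookup_minus left_diff_distrib)

lemma rescale_zero [simp]: "rescale a 0 = 0"
  by (rule poly_mapping_eqI) (simp add: lookup_rescale)

lemma rescale_single: "rescale a (single t c) = single t (c * mon_eval a t)"
  by (rule poly_mapping_eqI) (simp add: lookup_rescale lookup_single when_def)

lemma rescale_mult: "rescale a (p * q) = rescale a p * rescale a q"
proof -
  \<comment> \<open>Both sides are biadditive: the reduction to single terms is made first in
    \<open>q\<close> and afterwards in \<open>p\<close>.\<close>
  have single: "q \<in> {q. rescale a (single t c * q) = rescale a (single t c) * rescale a q}" for t c
    by (rule keys_subset_closure[where T = UNIV])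
      (auto simp: rescale_add rescale_single mult_single mon_eval_add distrib_left distrib_right mult_ac)
  have "p \<in> {p. rescale a (p * q) = rescale a p * rescale a q}"
    by (rule keys_subset_closure[where T = UNIV]) (use single in \<open>auto simp: rescale_add distrib_right\<close>)
  then show ?thesis by simp
qed

lemma rescale_one: "rescale a 1 = 1"
  using rescale_single[of a 0 1] by (simp add: mon_eval_def)

lemma rescale_power: "rescale a (p ^ j) = rescale a p ^ j"
  by (induction j) (simp_all add: rescale_one rescale_mult)

lemma keys_rescale_subset: "keys (rescale a p) \<subseteq> keys p"
  by (auto simp: in_keys_iff lookup_rescale)

lemma rescale_inverse:
  "(\<And>x. a x \<noteq> 0) \<Longrightarrow> rescale (\<lambda>x. inverse (a x)) (rescale a p) = p"
  by (rule poly_mapping_eqI) (simp add: lookup_rescale mult.assoc mon_eval_inverse)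

lemma rescale_in_forms: "p \<in> forms i \<Longrightarrow> rescale a p \<in> forms i"
  using keys_rescale_subset[of a p] by (auto simp: forms_def)

lemma rescale_in_supp_ideal: "p \<in> supp_ideal S \<Longrightarrow> rescale a p \<in> supp_ideal S"
  using keys_rescale_subset[of a p] by (auto simp: supp_ideal_def)

lemma mult_inj_rescale:
  assumes "\<And>x. a x \<noteq> 0" and "mult_inj (supp_ideal S) (rescale a f) i"
  shows "mult_inj (supp_ideal S) f i"
  unfolding mult_inj_def
proof (intro ballI impI)
  fix p assume p: "p \<in> forms i" "f * p \<in> supp_ideal S"
  then have "rescale a f * rescale a p \<in> supp_ideal S"
    using rescale_in_supp_ideal[OF p(2), of a] by (simp only: rescale_mult)
  then have "rescale a p \<in> supp_ideal S"
    using assms(2) rescale_in_forms[OF p(1)] by (auto simp: mult_inj_def)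
  from rescale_in_supp_ideal[OF this, of "\<lambda>x. inverse (a x)"] show "p \<in> supp_ideal S"
    by (simp only: rescale_inverse[OF assms(1)])
qed

lemma mult_surj_rescale:
  fixes f :: "('n::finite, 'k::field_char_0) mpoly"
  assumes nz: "\<And>x. a x \<noteq> 0" and surj: "mult_surj (supp_ideal S) (rescale a f) i j"
  shows "mult_surj (supp_ideal S) f i j"
  unfolding mult_surj_def
proof
  let ?a' = "\<lambda>x. inverse (a x)"
  fix q :: "('n, 'k) mpoly" assume "q \<in> forms j"
  then obtain p where p: "p \<in> forms i" "rescale a q - rescale a f * p \<in> supp_ideal S"
    using surj rescale_in_forms unfolding mult_surj_def by blast
  have "rescale ?a' (rescale a q - rescale a f * p) = q - f * rescale ?a' p"
    by (simp add: rescale_diff rescale_mult rescale_inverse[OF nz])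
  then have "q - f * rescale ?a' p \<in> supp_ideal S"
    using rescale_in_supp_ideal[OF p(2)] by metis
  then show "\<exists>p\<in>forms i. q - f * p \<in> supp_ideal S"
    using rescale_in_forms[OF p(1)] by blast
qed

section \<open>The sum of the variables as a common Lefschetz element\<close>

lemma mdeg_eq_1: "mdeg t = 1 \<Longrightarrow> \<exists>x. t = single x 1"
proof -
  assume "mdeg t = 1"
  then have "\<exists>x\<in>UNIV. lookup t x = 1 \<and> (\<forall>y\<in>UNIV. x \<noteq> y \<longrightarrow> lookup t y = 0)"
    using sum_eq_1_iff[of UNIV "lookup t"] by (simp add: mdeg_def)
  then obtain x where "lookup t x = 1" "\<And>y. x \<noteq> y \<Longrightarrow> lookup t y = 0" by auto
  then have "t = single x 1"
    by (intro poly_mapping_eqI) (auto simp: lookup_single when_def)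
  then show ?thesis ..
qed

lemma single_var_eq_iff: "single x (1 :: nat) = single y 1 \<longleftrightarrow> x = y"
  by (metis keys_single singleton_inject zero_neq_one)

definition var_sum :: "('n::finite, 'k::field_char_0) mpoly" where
  "var_sum = (\<Sum>x\<in>UNIV. single (single x 1) 1)"

lemma lookup_var_sum:
  "lookup (var_sum :: ('n::finite, 'k::field_char_0) mpoly) t = (if mdeg t = 1 then 1 else 0)"
proof (cases "mdeg t = 1")
  case True
  then obtain y where "t = single y 1" using mdeg_eq_1 by blast
  then show ?thesis using True
    by (simp add: var_sum_def lookup_sum lookup_single when_def single_var_eq_iff[unfolded One_nat_def])
next
  case False
  have "mdeg (single x 1) = 1" for x :: 'n
    by (simp add: mdeg_def lookup_single when_def)
  then show ?thesis using False
    by (auto simp: var_sum_def lookup_sum lookup_single when_def intro!: sum.neutral)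
qed

lemma var_sum_in_forms: "var_sum \<in> forms 1"
  by (auto simp: forms_def in_keys_iff lookup_var_sum split: if_splits)

lemma max_rank_var_sum:
  fixes l :: "('n::finite, 'k::field_char_0) mpoly"
  assumes up: "upclosed S" and l: "l \<in> forms 1" and rk: "mult_max_rank (supp_ideal S) j (l ^ j)"
  shows "mult_max_rank (supp_ideal S) j (var_sum ^ j :: ('n, 'k) mpoly)"
proof -
  note id = ideal_supp_ideal[OF up]
  \<comment> \<open>\<open>l\<close> is the weight-0 part of \<open>\<Sum> c\<^sub>x x\<close>, where the variables missing in \<open>l\<close> get weight 1\<close>
  define c where "c x = (if lookup l (single x 1) = 0 then 1 else lookup l (single x 1))" for x
  define \<omega> where "\<omega> t = int (\<Sum>x\<in>{x. lookup l (single x 1) = 0}. lookup t x)" for t :: "'n mon"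
  \<comment> \<open>The value 1 for variables missing in \<open>l\<close> keeps the rescaling
    invertible; their weight 1 removes them from the weight-0 part again.\<close>
  have nz: "c x \<noteq> 0" for x by (simp add: c_def)
  have \<omega>_add: "\<omega> (s + t) = \<omega> s + \<omega> t" for s t by (simp add: \<omega>_def lookup_add sum.distrib)
  have nonneg: "0 \<le> \<omega> s" for s unfolding \<omega>_def by (rule of_nat_0_le_iff)
  have bound: "\<omega> s \<le> int (mdeg s)" for s
    unfolding \<omega>_def mdeg_def of_nat_le_iff by (rule sum_mono2) auto
  let ?L = "rescale c var_sum :: ('n, 'k) mpoly"
  have L: "?L ^ j \<in> forms (int j)"
    by (intro forms_power rescale_in_forms var_sum_in_forms)
  have "part (\<lambda>t. \<omega> t = 0) ?L = l"
  proof (rule poly_mapping_eqI)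
    fix t :: "'n mon"
    show "lookup (part (\<lambda>t. \<omega> t = 0) ?L) t = lookup l t"
    proof (cases "mdeg t = 1")
      case True
      then obtain x where t: "t = single x 1" using mdeg_eq_1 by blast
      have "\<omega> t = (if lookup l t = 0 then 1 else 0)"
        by (simp add: \<omega>_def t lookup_single when_def sum.delta')
      then show ?thesis
        using True by (simp add: lookup_part lookup_rescale lookup_var_sum t mon_eval_var[unfolded One_nat_def] c_def)
    next
      case False
      then have "lookup l t = 0" using l by (force simp: forms_def in_keys_iff)
      then show ?thesis using False by (simp add: lookup_part lookup_rescale lookup_var_sum)
    qed
  qed
  then have low: "part (\<lambda>t. \<omega> t = 0) (?L ^ j) = l ^ j"
    by (simp add: part_power_lowest[OF \<omega>_add nonneg])
  have "mult_inj (supp_ideal S) (var_sum ^ j :: ('n, 'k) mpoly) i \<or>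
      mult_surj (supp_ideal S) (var_sum ^ j :: ('n, 'k) mpoly) i (i + int j)" for i
  proof -
    have "mult_inj (supp_ideal S) (l ^ j) i \<or> mult_surj (supp_ideal S) (l ^ j) i (i + int j)"
      using rk by (simp add: mult_max_rank_iff[OF id forms_power[OF l]])
    then have "mult_inj (supp_ideal S) (?L ^ j) i \<or> mult_surj (supp_ideal S) (?L ^ j) i (i + int j)"
      using mult_inj_lowest[OF up \<omega>_add nonneg, of "?L ^ j" i]
        mult_surj_lowest[OF up \<omega>_add nonneg bound L, of i] by (auto simp: low)
    then show ?thesis
      \<comment> \<open>The power of the rescaled form is the rescaled power, so undoing the
        rescaling leaves \<open>var_sum ^ j\<close>.\<close>
      unfolding rescale_power[symmetric]
      using mult_inj_rescale[of c, OF nz] mult_surj_rescale[of c, OF nz] by blast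
  qed
  then show ?thesis
    by (simp add: mult_max_rank_iff[OF id forms_power[OF var_sum_in_forms]])
qed

text \<open>Replaces the existentially quantified linear form by one that is independent of the
  ideal, so that separate witnesses for \<open>I\<close> and \<open>J\<close> become a common
  one.\<close>

lemma WLP_iff:
  assumes up: "upclosed S"
  shows "WLP (supp_ideal S :: ('n::finite, 'k::field_char_0) mpoly set) \<longleftrightarrow>
    mult_max_rank (supp_ideal S :: ('n, 'k) mpoly set) 1 var_sum"
proof
  assume "WLP (supp_ideal S :: ('n, 'k) mpoly set)"
  then obtain l :: "('n, 'k) mpoly" where "l \<in> forms 1" "mult_max_rank (supp_ideal S) 1 l"
    by (auto simp: WLP_def)
  then show "mult_max_rank (supp_ideal S :: ('n, 'k) mpoly set) 1 var_sum"
    using max_rank_var_sum[OF up, of l 1] by simp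
qed (auto simp: WLP_def intro: var_sum_in_forms)

text \<open>The reduction may be made for each exponent separately, because \<open>var_sum\<close>
  does not depend on \<open>j\<close>.\<close>

lemma SLP_iff:
  assumes up: "upclosed S"
  shows "SLP (supp_ideal S :: ('n::finite, 'k::field_char_0) mpoly set) \<longleftrightarrow>
    (\<forall>j\<ge>1. mult_max_rank (supp_ideal S :: ('n, 'k) mpoly set) j (var_sum ^ j))"
proof
  assume "SLP (supp_ideal S :: ('n, 'k) mpoly set)"
  then obtain l :: "('n, 'k) mpoly"
    where "l \<in> forms 1" "\<forall>j\<ge>1. mult_max_rank (supp_ideal S) j (l ^ j)"
    by (auto simp: SLP_def)
  then show "\<forall>j\<ge>1. mult_max_rank (supp_ideal S :: ('n, 'k) mpoly set) j (var_sum ^ j)"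
    using max_rank_var_sum[OF up] by blast
qed (auto simp: SLP_def intro: var_sum_in_forms)

theorem theorem1:
  fixes K I J :: "('n::finite, 'k::field_char_0) mpoly set" and m :: "'n mon"
  assumes "monomial_ideal K"
    and "I = K <+>\<^bsub>poly_ring\<^esub> PIdl\<^bsub>poly_ring\<^esub> (mon_poly m)"
    and "J = colon_ideal K (PIdl\<^bsub>poly_ring\<^esub> (mon_poly m))"
  shows "(\<forall>d::nat. d > 0 \<longrightarrow> HF_compatible I J (mdeg m) d \<longrightarrow>
            (\<forall>f \<in> forms (int d).
               mult_max_rank I d f \<longrightarrow> mult_max_rank J d f \<longrightarrow> mult_max_rank K d f)) \<and>
         (HF_compatible I J (mdeg m) 1 \<longrightarrow> WLP I \<longrightarrow> WLP J \<longrightarrow> WLP K) \<and>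
         ((\<forall>d::nat. d \<ge> 1 \<longrightarrow> HF_compatible I J (mdeg m) d) \<longrightarrow> SLP I \<longrightarrow> SLP J \<longrightarrow> SLP K)"
proof -
  obtain S where up: "upclosed S" and K: "K = supp_ideal S"
    using monomial_ideal_eq_supp_ideal[OF assms(1)] by blast
  have I: "I = supp_ideal (S \<union> range (\<lambda>t. t + m))" and J: "J = supp_ideal {t. t + m \<in> S}"
    by (simp_all add: assms(2,3) K supp_ideal_add_mon[OF up] supp_ideal_colon_mon[OF up])
  have upI: "upclosed (S \<union> range (\<lambda>t. t + m))" and upJ: "upclosed {t. t + m \<in> S}"
    using up by (auto simp: upclosed_def add.assoc[symmetric])
  note rank = max_rank_exact[OF K up assms(2,3)]
  have WLP: "WLP K \<longleftrightarrow> mult_max_rank K 1 var_sum" "WLP I \<longleftrightarrow> mult_max_rank I 1 var_sum"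
      "WLP J \<longleftrightarrow> mult_max_rank J 1 var_sum"
    unfolding I J K by (intro WLP_iff up upI upJ)+
  have SLP: "SLP K \<longleftrightarrow> (\<forall>j\<ge>1. mult_max_rank K j (var_sum ^ j))"
      "SLP I \<longleftrightarrow> (\<forall>j\<ge>1. mult_max_rank I j (var_sum ^ j))"
      "SLP J \<longleftrightarrow> (\<forall>j\<ge>1. mult_max_rank J j (var_sum ^ j))"
    unfolding I J K by (intro SLP_iff up upI upJ)+
  have "WLP K" if "HF_compatible I J (mdeg m) 1" "WLP I" "WLP J"
    using that rank[of 1 var_sum] var_sum_in_forms unfolding WLP by simp
  \<comment> \<open>For each \<open>j\<close> the transfer is applied to the form
    \<open>var_sum ^ j\<close> of degree \<open>j\<close>, with the compatibility condition at
    \<open>d = j\<close>.\<close>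
  moreover have "SLP K" if "\<forall>d\<ge>1. HF_compatible I J (mdeg m) d" "SLP I" "SLP J"
    using that rank[OF _ forms_power[OF var_sum_in_forms]] unfolding SLP by blast
  ultimately show ?thesis using rank by blast
qed

end
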